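(* Let $x_1,x_2,\dots$ be independent identically distributed random variables in $[0,1]$ with common probability density $f$ such that $f(x)/(c x^{\beta})\to1$ as $x\to0^+$, where $c>0$ and $\beta\ge0$. Let $H_n$ be the harmonic mean of $x_1,\dots,x_n$ and let $a>0$. 1. If $\beta=0$, then $$\lim_{n\to\infty}\mathbf P\left(|H_n\log n-\mathfrak C_1|>a\right)=0,$$ where $\mathfrak C_1=\lim_{n\to\infty}\mathbf E(H_n\log n)$. 2. If $\beta>0$ and $\mathcal E=\mathbf E(1/x_1)$, then $$\lim_{n\to\infty}\mathbf P\left(\left|H_n-\frac1{\mathcal E}\right|>a\right)=0.$$
   Context: The harmonic mean is $H_n=1/X_n$ with $X_n=\frac1n\sum_{i=1}^n\frac1{x_i}$. In case $\beta=0$ the limit defining the constant $\mathfrak C_1$ exists and equals $1/c$. *)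

theory Defs
  imports "HOL-Probability.Probability"
begin

text \<open>
  Samples are sequences indexed from 1; the value at index 0 is not used. If some
  \<open>x i = 0\<close>, then \<open>1 / x i = 0\<close> by the HOL convention for division; for random
  variables that have a density this concerns only a null event.
\<close>

definition inverse_mean :: "(nat \<Rightarrow> real) \<Rightarrow> nat \<Rightarrow> real" where
  "inverse_mean x n = (1 / real n) * (\<Sum>i = 1..n. 1 / x i)"

definition harmonic_mean :: "(nat \<Rightarrow> real) \<Rightarrow> nat \<Rightarrow> real" where
  "harmonic_mean x n = 1 / inverse_mean x n"

end

theory Submission imports Defs "HOL-Real_Asymp.Real_Asymp" begin

text \<open>
  Let \<open>X n\<close> be the mean of the reciprocals. Replace \<open>1 / t\<close> by \<open>0\<close> for \<open>t < s\<close>: Chebyshev's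
  inequality controls the deviation of the truncated mean from its expectation, and a union
  bound the probability that truncation changes anything. For \<open>\<beta> > 0\<close> the reciprocals are
  integrable and \<open>s = 1 / n\<close> gives \<open>X n \<rightarrow> \<E>\<close> in probability by dominated convergence. For
  \<open>\<beta> = 0\<close> the truncated expectation is asymptotic to \<open>c * ln (1 / s)\<close>, the truncated second
  moment is \<open>O(1 / s)\<close>, and \<open>s = 1 / (n * sqrt (ln n))\<close> gives \<open>X n / ln n \<rightarrow> c\<close> in probability.
  Moreover truncation only decreases \<open>X n\<close>, so Chebyshev alone shows that
  \<open>X n / ln n \<le> c / 2\<close> has probability \<open>o(1 / ln n)\<close>. As \<open>X n \<ge> 1\<close> almost surely, the variable
  \<open>ln n / X n\<close> is at most \<open>ln n\<close> on that event, hence its expectation converges to \<open>1 / c\<close>.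
\<close>

section \<open>Chebyshev's inequality for averages of bounded independent variables\<close>

text \<open>In the expanded square of the centred sum the off-diagonal products have mean 0 by
  independence, and each diagonal term has mean \<open>v - \<mu>\<^sup>2\<close>, which is at most
  \<open>v\<close>. Markov's inequality for the squared sum gives the bound. The uniform bound
  \<open>B\<close> supplies the integrability of all products.\<close>

lemma (in prob_space) prob_mean_deviation_le:
  fixes Z :: "nat \<Rightarrow> 'a \<Rightarrow> real"
  assumes indep: "indep_vars (\<lambda>_. borel) Z {1..n}"
    and bd: "\<And>i \<omega>. \<bar>Z i \<omega>\<bar> \<le> B"
    and mean: "\<And>i. i \<in> {1..n} \<Longrightarrow> expectation (Z i) = \<mu>"
    and sq: "\<And>i. i \<in> {1..n} \<Longrightarrow> expectation (\<lambda>\<omega>. (Z i \<omega>)\<^sup>2) = v"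
    and n: "n > 0" and \<epsilon>: "\<epsilon> > 0"
  shows "prob {\<omega> \<in> space M. \<epsilon> \<le> \<bar>(\<Sum>i=1..n. Z i \<omega>) / n - \<mu>\<bar>} \<le> v / (n * \<epsilon>\<^sup>2)"
proof -
  define U where "U = (\<lambda>i \<omega>. Z i \<omega> - \<mu>)"
  have Z[measurable]: "random_variable borel (Z i)" if "i \<in> {1..n}" for i
    using indep that unfolding indep_vars_def by auto
  have Z_int: "integrable M (Z i)" if "i \<in> {1..n}" for i
    using that bd by (intro integrable_const_bound[of _ B]) auto
  have Z2_int: "integrable M (\<lambda>\<omega>. (Z i \<omega>)\<^sup>2)" if "i \<in> {1..n}" for i
    using that bd by (intro integrable_const_bound[of _ "B\<^sup>2"]) (auto intro!: abs_le_square_iff[THEN iffD1] AE_I2 order_trans[OF bd])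
  have U[measurable]: "random_variable borel (U i)" if "i \<in> {1..n}" for i
    using that unfolding U_def by measurable
  have U_int: "integrable M (U i)" if "i \<in> {1..n}" for i
    using that Z_int unfolding U_def by simp
  have U_mean: "expectation (U i) = 0" if "i \<in> {1..n}" for i
    using that Z_int mean unfolding U_def by (simp add: prob_space)
  have U_bd: "\<bar>U i \<omega>\<bar> \<le> B + \<bar>\<mu>\<bar>" for i \<omega>
    using bd[of i \<omega>] unfolding U_def by linarith
  have UU_int: "integrable M (\<lambda>\<omega>. U i \<omega> * U j \<omega>)" if "i \<in> {1..n}" "j \<in> {1..n}" for i j
    using that U_bd by (intro integrable_const_bound[of _ "(B + \<bar>\<mu>\<bar>) * (B + \<bar>\<mu>\<bar>)"])
      (auto simp: abs_mult intro!: mult_mono AE_I2 order_trans[OF abs_ge_zero U_bd])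
  have U_indep: "indep_vars (\<lambda>_. borel) U {1..n}"
    unfolding U_def by (rule indep_vars_compose2[OF indep]) auto
  \<comment> \<open>The product rule over the two-element index set \<open>{i, j}\<close> factors
    the expectation into two vanishing means.\<close>
  have cross: "expectation (\<lambda>\<omega>. U i \<omega> * U j \<omega>) = 0"
    if "i \<in> {1..n}" "j \<in> {1..n}" "i \<noteq> j" for i j
    using indep_vars_lebesgue_integral[OF _ indep_vars_subset[OF U_indep, of "{i, j}"] U_int] that
      U_mean by auto
  have diag: "expectation (\<lambda>\<omega>. U i \<omega> * U i \<omega>) \<le> v" if "i \<in> {1..n}" for i
  proof -
    have "expectation (\<lambda>\<omega>. U i \<omega> * U i \<omega>) = expectation (\<lambda>\<omega>. (Z i \<omega>)\<^sup>2 - 2 * \<mu> * Z i \<omega> + \<mu>\<^sup>2)"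
      unfolding U_def by (intro Bochner_Integration.integral_cong) (auto simp: power2_eq_square algebra_simps)
    also have "\<dots> = v - 2 * \<mu> * \<mu> + \<mu>\<^sup>2"
      using that Z_int Z2_int mean sq by (simp add: prob_space)
    also have "\<dots> \<le> v" by (simp add: power2_eq_square)
    finally show ?thesis .
  qed
  let ?S = "\<lambda>\<omega>. \<Sum>i=1..n. U i \<omega>"
  have sq_eq: "(?S \<omega>)\<^sup>2 = (\<Sum>i=1..n. \<Sum>j=1..n. U i \<omega> * U j \<omega>)" for \<omega>
    by (simp add: power2_eq_square sum_product)
  have S2_int: "integrable M (\<lambda>\<omega>. (?S \<omega>)\<^sup>2)"
    unfolding sq_eq using UU_int by (intro Bochner_Integration.integrable_sum) auto
  have "expectation (\<lambda>\<omega>. (?S \<omega>)\<^sup>2) = (\<Sum>i=1..n. expectation (\<lambda>\<omega>. \<Sum>j=1..n. U i \<omega> * U j \<omega>))"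
    unfolding sq_eq using UU_int
    by (intro Bochner_Integration.integral_sum Bochner_Integration.integrable_sum)
  also have "\<dots> = (\<Sum>i=1..n. \<Sum>j=1..n. expectation (\<lambda>\<omega>. U i \<omega> * U j \<omega>))"
    using UU_int by (intro sum.cong refl Bochner_Integration.integral_sum)
  also have "\<dots> = (\<Sum>i=1..n. \<Sum>j=1..n. if j = i then expectation (\<lambda>\<omega>. U i \<omega> * U i \<omega>) else 0)"
    using cross by (intro sum.cong) auto
  also have "\<dots> \<le> (\<Sum>i=1..n. v)"
    using diag by (intro sum_mono) (auto simp: sum.delta)
  finally have S2: "expectation (\<lambda>\<omega>. (?S \<omega>)\<^sup>2) \<le> n * v" by simp
  have "{\<omega> \<in> space M. \<epsilon> \<le> \<bar>(\<Sum>i=1..n. Z i \<omega>) / n - \<mu>\<bar>} = {\<omega> \<in> space M. (n * \<epsilon>)\<^sup>2 \<le> (?S \<omega>)\<^sup>2}"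
  proof -
    have "\<epsilon> \<le> \<bar>(\<Sum>i=1..n. Z i \<omega>) / n - \<mu>\<bar> \<longleftrightarrow> (n * \<epsilon>)\<^sup>2 \<le> (?S \<omega>)\<^sup>2" for \<omega>
    proof -
      have "(\<Sum>i=1..n. Z i \<omega>) / n - \<mu> = ?S \<omega> / n"
        using n by (simp add: U_def sum_subtractf field_simps)
      then show ?thesis
        using n \<epsilon> abs_le_square_iff[of "n * \<epsilon>" "?S \<omega>"] by (simp add: abs_mult field_simps)
    qed
    then show ?thesis by simp
  qed
  also have "prob \<dots> \<le> expectation (\<lambda>\<omega>. (?S \<omega>)\<^sup>2) / (n * \<epsilon>)\<^sup>2"
    using n \<epsilon> S2_int by (intro integral_Markov_inequality_measure[where A = "{}"]) auto
  also have "\<dots> \<le> n * v / (n * \<epsilon>)\<^sup>2"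
    using S2 by (intro divide_right_mono) auto
  also have "\<dots> = v / (n * \<epsilon>\<^sup>2)"
    using n \<epsilon> by (simp add: power2_eq_square field_simps)
  finally show ?thesis .
qed

section \<open>Reciprocals of variables that converge in probability\<close>

text \<open>The first entry of the minimum forces \<open>A > m / 2\<close>, so
  \<open>\<bar>1 / A - 1 / m\<bar> = \<bar>A - m\<bar> / (A * m)\<close> is at most
  \<open>2 * \<bar>A - m\<bar> / m\<^sup>2\<close>, and the second entry makes this less than
  \<open>a\<close>.\<close>

lemma abs_reciprocal_diff_less:
  fixes A m a :: real
  assumes "m > 0" and "\<bar>A - m\<bar> < min (m / 2) (a * m\<^sup>2 / 2)"
  shows "\<bar>1 / A - 1 / m\<bar> < a"
proof -
  have A: "A > m / 2" using assms by linarith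
  then have "A > 0" using assms by linarith
  have "\<bar>1 / A - 1 / m\<bar> = \<bar>A - m\<bar> / (A * m)"
    using \<open>A > 0\<close> assms(1) by (simp add: field_simps abs_if)
  also have "\<dots> < a"
  proof -
    \<comment> \<open>Positivity of \<open>a\<close> comes from the hypothesis itself: an absolute
      value lies below \<open>a * m\<^sup>2 / 2\<close>.\<close>
    have "0 < a * m\<^sup>2 / 2" using assms(2) by (smt (verit))
    then have "a > 0" using assms(1) by (simp add: zero_less_mult_iff)
    have "a * m\<^sup>2 / 2 = a * (m / 2 * m)" by (simp add: power2_eq_square)
    also have "\<dots> \<le> a * (A * m)" using A assms(1) \<open>a > 0\<close> by (intro mult_left_mono mult_right_mono) auto
    finally have "\<bar>A - m\<bar> < a * (A * m)" using assms(2) by linarith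
    then show ?thesis using \<open>A > 0\<close> assms(1) by (simp add: field_simps)
  qed
  finally show ?thesis .
qed

text \<open>Continuous mapping at \<open>m\<close>: by the quantitative bound for reciprocals, a
  deviation of \<open>1 / A n\<close> beyond \<open>a\<close> forces a deviation of
  \<open>A n\<close> by at least a fixed positive amount.\<close>

lemma (in prob_space) reciprocal_tendsto_in_prob:
  fixes A :: "nat \<Rightarrow> 'a \<Rightarrow> real"
  assumes [measurable]: "\<And>n. random_variable borel (A n)"
    and m: "m > 0" and a: "a > 0"
    and conv: "\<And>\<epsilon>. \<epsilon> > 0 \<Longrightarrow> (\<lambda>n. prob {\<omega> \<in> space M. \<epsilon> \<le> \<bar>A n \<omega> - m\<bar>}) \<longlonglongrightarrow> 0"
  shows "(\<lambda>n. prob {\<omega> \<in> space M. \<bar>1 / A n \<omega> - 1 / m\<bar> > a}) \<longlonglongrightarrow> 0"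
proof (rule tendsto_sandwich[OF _ _ tendsto_const conv])
  let ?e = "min (m / 2) (a * m\<^sup>2 / 2)"
  show "?e > 0" using m a by simp
  show "\<forall>\<^sub>F n in sequentially. prob {\<omega> \<in> space M. \<bar>1 / A n \<omega> - 1 / m\<bar> > a}
      \<le> prob {\<omega> \<in> space M. ?e \<le> \<bar>A n \<omega> - m\<bar>}"
    using abs_reciprocal_diff_less[OF m]
    by (intro always_eventually allI finite_measure_mono) (auto simp: not_le[symmetric] simp del: min_less_iff_conj, force)
qed auto

text \<open>
  The bound \<open>1 / A n \<le> L n\<close> may blow up: it only matters on the event where \<open>A n\<close> is small.
\<close>

lemma (in prob_space) expectation_reciprocal_tendsto:
  fixes A :: "nat \<Rightarrow> 'a \<Rightarrow> real"
  assumes [measurable]: "\<And>n. random_variable borel (A n)"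
    and m: "m > 0"
    and conv: "\<And>\<epsilon>. \<epsilon> > 0 \<Longrightarrow> (\<lambda>n. prob {\<omega> \<in> space M. \<epsilon> \<le> \<bar>A n \<omega> - m\<bar>}) \<longlonglongrightarrow> 0"
    and bound: "\<forall>\<^sub>F n in sequentially. L n > 0 \<and> (AE \<omega> in M. 1 / L n \<le> A n \<omega>)"
    and small: "(\<lambda>n. L n * prob {\<omega> \<in> space M. A n \<omega> \<le> m / 2}) \<longlonglongrightarrow> 0"
  shows "(\<lambda>n. expectation (\<lambda>\<omega>. 1 / A n \<omega>)) \<longlonglongrightarrow> 1 / m"
proof (rule tendstoI)
  fix e :: real assume e: "e > 0"
  define p where "p n = prob {\<omega> \<in> space M. \<bar>1 / A n \<omega> - 1 / m\<bar> > e / 2}" for n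
  define q where "q n = prob {\<omega> \<in> space M. A n \<omega> \<le> m / 2}" for n
  have p: "p \<longlonglongrightarrow> 0"
    unfolding p_def using m e conv by (intro reciprocal_tendsto_in_prob) auto
  have q: "q \<longlonglongrightarrow> 0"
  proof (rule tendsto_sandwich[OF _ _ tendsto_const conv[of "m / 2"]])
    show "\<forall>\<^sub>F n in sequentially. q n \<le> prob {\<omega> \<in> space M. m / 2 \<le> \<bar>A n \<omega> - m\<bar>}"
      unfolding q_def by (intro always_eventually allI finite_measure_mono) (auto simp: abs_if field_simps)
  qed (use m q_def in auto)
  \<comment> \<open>This sequence will bound the expected distance. \<open>L n * q n\<close> and
    \<open>1 / m * q n\<close> stay apart because they vanish for different reasons: the first by
    \<open>small\<close>, the second by convergence in probability.\<close>
  have "(\<lambda>n. e / 2 + 3 / m * p n + (L n * q n + 1 / m * q n)) \<longlonglongrightarrow> e / 2 + 3 / m * 0 + (0 + 1 / m * 0)"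
    using p q small unfolding q_def by (intro tendsto_intros)
  from order_tendstoD(2)[OF this, of e]
  have "\<forall>\<^sub>F n in sequentially. e / 2 + 3 / m * p n + (L n * q n + 1 / m * q n) < e"
    using e by simp
  then show "\<forall>\<^sub>F n in sequentially. dist (expectation (\<lambda>\<omega>. 1 / A n \<omega>)) (1 / m) < e"
    using bound
  proof eventually_elim
    case (elim n)
    then have L: "L n > 0" and AE_L: "AE \<omega> in M. 1 / L n \<le> A n \<omega>" by auto
    have int: "integrable M (\<lambda>\<omega>. 1 / A n \<omega>)"
    proof (rule integrable_const_bound[of _ "L n"])
      show "AE \<omega> in M. norm (1 / A n \<omega>) \<le> L n"
        using AE_L
      proof eventually_elim
        case (elim \<omega>)
        have "A n \<omega> > 0" using elim L by (smt (verit) divide_pos_pos)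
        then show ?case using elim L by (simp add: field_simps)
      qed
    qed simp
    let ?I = "\<lambda>\<omega>. indicat_real {\<omega> \<in> space M. \<bar>1 / A n \<omega> - 1 / m\<bar> > e / 2} \<omega>"
    let ?J = "\<lambda>\<omega>. indicat_real {\<omega> \<in> space M. A n \<omega> \<le> m / 2} \<omega>"
    \<comment> \<open>Three regions: the reciprocals differ by at most \<open>e / 2\<close>; they
      differ by more but \<open>A n \<omega> > m / 2\<close>, so the distance is at most
      \<open>2 / m + 1 / m\<close>; or \<open>A n \<omega>\<close> is small and only
      \<open>L n\<close> bounds its reciprocal.\<close>
    have le: "AE \<omega> in M. \<bar>1 / A n \<omega> - 1 / m\<bar> \<le> e / 2 + 3 / m * ?I \<omega> + (L n + 1 / m) * ?J \<omega>"
      using AE_L AE_space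
    proof eventually_elim
      case (elim \<omega>)
      have pos: "A n \<omega> > 0" using elim L by (smt (verit) divide_pos_pos)
      have up: "1 / A n \<omega> \<le> L n" using elim L pos by (simp add: field_simps)
      have tri: "\<bar>1 / A n \<omega> - 1 / m\<bar> \<le> 1 / A n \<omega> + 1 / m"
        using pos m by (simp add: abs_if)
      show ?case
      proof (cases "A n \<omega> \<le> m / 2")
        case True
        then have "(L n + 1 / m) * ?J \<omega> = L n + 1 / m" using elim by simp
        moreover have "0 \<le> 3 / m * ?I \<omega>" using m by simp
        ultimately show ?thesis using tri up e by linarith
      next
        case False
        then have J: "?J \<omega> = 0" by simp
        have "1 / A n \<omega> \<le> 2 / m" using False m pos by (simp add: field_simps)
        then have "\<bar>1 / A n \<omega> - 1 / m\<bar> \<le> 3 / m" using tri by (simp add: add_divide_distrib[symmetric])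
        then show ?thesis using J e elim by (auto simp: indicator_def)
      qed
    qed
    have "\<bar>expectation (\<lambda>\<omega>. 1 / A n \<omega>) - 1 / m\<bar> = \<bar>expectation (\<lambda>\<omega>. 1 / A n \<omega> - 1 / m)\<bar>"
      using int by (simp add: prob_space)
    also have "\<dots> \<le> expectation (\<lambda>\<omega>. \<bar>1 / A n \<omega> - 1 / m\<bar>)"
      by (rule integral_abs_bound)
    also have "\<dots> \<le> expectation (\<lambda>\<omega>. e / 2 + 3 / m * ?I \<omega> + (L n + 1 / m) * ?J \<omega>)"
      using int le by (intro integral_mono_AE) (auto simp: emeasure_eq_measure)
    also have "\<dots> = e / 2 + 3 / m * p n + (L n + 1 / m) * q n"
      by (simp add: emeasure_eq_measure prob_space p_def q_def)
    also have "\<dots> < e" using elim by (simp add: algebra_simps)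
    finally show ?case by (simp add: dist_real_def)
  qed
qed

section \<open>Truncated reciprocals\<close>

text \<open>For \<open>s > 0\<close> the value is also 0 at all \<open>t \<le> 0\<close>, so the
  function is bounded on the whole line, as the deviation inequality demands at every point of the
  probability space.\<close>

definition recip_above :: "real \<Rightarrow> real \<Rightarrow> real" where
  "recip_above s t = (if s \<le> t then 1 / t else 0)"

lemma measurable_recip_above [measurable]: "recip_above s \<in> borel_measurable borel"
  unfolding recip_above_def by measurable

lemma recip_above_bounds:
  assumes "s > 0"
  shows "0 \<le> recip_above s t" "recip_above s t \<le> 1 / s"
  using assms by (auto simp: recip_above_def frac_le)

lemma recip_above_le_reciprocal: "t \<ge> 0 \<Longrightarrow> recip_above s t \<le> 1 / t"
  by (simp add: recip_above_def)

section \<open>Samples with a common density on the unit interval\<close>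

text \<open>Identical distribution is expressed by the common density \<open>f\<close>. The
  behaviour of \<open>f\<close> at 0 stays outside the locale, since the two cases use it in
  different forms.\<close>

locale unit_sample = prob_space +
  fixes x :: "nat \<Rightarrow> 'a \<Rightarrow> real" and f :: "real \<Rightarrow> real"
  assumes indep: "indep_vars (\<lambda>_. borel) x {1..}"
    and unit_range: "i \<ge> 1 \<Longrightarrow> AE \<omega> in M. x i \<omega> \<in> {0..1}"
    and density_nonneg: "f t \<ge> 0"
    and density: "i \<ge> 1 \<Longrightarrow> distributed M lborel (x i) (\<lambda>t. ennreal (f t))"
begin

lemma measurable_sample: "i \<ge> 1 \<Longrightarrow> random_variable borel (x i)"
  using indep unfolding indep_vars_def by auto

lemma measurable_sample_1 [measurable]: "random_variable borel (x 1)"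
  "random_variable borel (x (Suc 0))"
  using measurable_sample[of 1] by auto

lemma measurable_density [measurable]: "f \<in> borel_measurable borel"
  using distributed_real_measurable[OF density_nonneg density[of 1]] by simp

lemma measurable_inverse_mean [measurable]:
  "random_variable borel (\<lambda>\<omega>. inverse_mean (\<lambda>i. x i \<omega>) n)"
  unfolding inverse_mean_def using measurable_sample by measurable

lemma expectation_sample:
  assumes "g \<in> borel_measurable borel" "i \<ge> 1"
  shows "expectation (\<lambda>\<omega>. g (x i \<omega>)) = (LINT t|lborel. f t * g t)"
  using distributed_integral[OF density] assms density_nonneg by simp

lemma integrable_sample_iff:
  assumes "g \<in> borel_measurable borel" "i \<ge> 1"
  shows "integrable M (\<lambda>\<omega>. g (x i \<omega>)) \<longleftrightarrow> integrable lborel (\<lambda>t. f t * (g t :: real))"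
  using distributed_integrable[OF density] assms density_nonneg by simp

text \<open>A distribution with a density has no atom at 0, so values in the closed unit interval
  are almost surely positive and the convention \<open>1 / 0 = 0\<close> affects only a null
  event.\<close>

lemma AE_sample_pos:
  assumes "i \<ge> 1"
  shows "AE \<omega> in M. 0 < x i \<omega> \<and> x i \<omega> \<le> 1"
proof -
  have "AE t in distr M lborel (x i). t \<noteq> 0"
    unfolding distributed_distr_eq_density[OF density[OF assms]]
    using AE_lborel_singleton[of "0::real"] by (subst AE_density) auto
  then have "AE \<omega> in M. x i \<omega> \<noteq> 0"
    using measurable_sample[OF assms] by (subst (asm) AE_distr_iff) auto
  then show ?thesis using unit_range[OF assms] by eventually_elim auto
qed

lemma AE_all_sample_pos: "AE \<omega> in M. \<forall>i\<in>{1..n}. 0 < x i \<omega> \<and> x i \<omega> \<le> 1"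
  using AE_sample_pos by (intro AE_finite_allI) auto

text \<open>Every reciprocal of a number in \<open>{0<..1}\<close> is at least 1. This yields the
  crude upper bound \<open>ln n\<close> for the scaled harmonic mean.\<close>

lemma AE_inverse_mean_ge_1:
  assumes "n > 0"
  shows "AE \<omega> in M. 1 \<le> inverse_mean (\<lambda>i. x i \<omega>) n"
  using AE_all_sample_pos[of n]
proof eventually_elim
  case (elim \<omega>)
  then have "(\<Sum>i=1..n. 1) \<le> (\<Sum>i=1..n. 1 / x i \<omega>)"
    by (intro sum_mono) auto
  then show ?case using assms by (simp add: inverse_mean_def field_simps)
qed

section \<open>Deviation of the mean of reciprocals from its truncated expectation\<close>

text \<open>Index 1 stands for every index: expectations of functions of a single sample depend only
  on \<open>f\<close>.\<close>

definition trunc_mean :: "real \<Rightarrow> real" where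
  "trunc_mean s = expectation (\<lambda>\<omega>. recip_above s (x 1 \<omega>))"

definition trunc_sq :: "real \<Rightarrow> real" where
  "trunc_sq s = expectation (\<lambda>\<omega>. (recip_above s (x 1 \<omega>))\<^sup>2)"

lemma integrable_recip_above: "s > 0 \<Longrightarrow> integrable M (\<lambda>\<omega>. recip_above s (x 1 \<omega>))"
  using recip_above_bounds by (intro integrable_const_bound[of _ "1 / s"]) auto

lemma integrable_recip_above_sq: "s > 0 \<Longrightarrow> integrable M (\<lambda>\<omega>. (recip_above s (x 1 \<omega>))\<^sup>2)"
  using recip_above_bounds by (intro integrable_const_bound[of _ "(1 / s)\<^sup>2"]) (auto intro!: power_mono)

text \<open>Both sides are the same integral against \<open>f\<close>. The right-hand form suits
  dominated convergence and estimates by the density near 0.\<close>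

lemma prob_sample_less:
  assumes "i \<ge> 1"
  shows "prob {\<omega> \<in> space M. x i \<omega> < s} = expectation (\<lambda>\<omega>. indicator {..<s} (x 1 \<omega>))"
proof -
  note measurable_sample[OF assms, measurable]
  have "prob {\<omega> \<in> space M. x i \<omega> < s} = expectation (indicator {\<omega> \<in> space M. x i \<omega> < s})"
    by (simp add: emeasure_eq_measure)
  also have "\<dots> = expectation (\<lambda>\<omega>. indicator {..<s} (x i \<omega>))"
    by (intro Bochner_Integration.integral_cong) (auto simp: indicator_def)
  also have "\<dots> = expectation (\<lambda>\<omega>. indicator {..<s} (x 1 \<omega>))"
    using assms by (simp add: expectation_sample)
  finally show ?thesis .
qed

lemma truncated_deviation:
  assumes "n > 0" "s > 0" "\<epsilon> > 0"
  shows "prob {\<omega> \<in> space M. \<epsilon> \<le> \<bar>(\<Sum>i=1..n. recip_above s (x i \<omega>)) / n - trunc_mean s\<bar>}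
    \<le> trunc_sq s / (n * \<epsilon>\<^sup>2)"
proof (rule prob_mean_deviation_le[where B = "1 / s"])
  show "indep_vars (\<lambda>_. borel) (\<lambda>i \<omega>. recip_above s (x i \<omega>)) {1..n}"
    by (rule indep_vars_compose2[OF indep_vars_subset[OF indep]]) auto
qed (use assms recip_above_bounds[of s] in
  \<open>auto simp: trunc_mean_def trunc_sq_def expectation_sample
    expectation_sample[where g = "\<lambda>t. (recip_above s t)\<^sup>2"]\<close>)

text \<open>Truncation only lowers the mean when the samples are positive, so a low full mean forces
  a low truncated mean. Hence no union-bound term appears, which lets the estimate survive a factor
  \<open>ln n\<close>.\<close>

lemma prob_inverse_mean_lower:
  assumes "n > 0" "s > 0" "\<epsilon> > 0"
  shows "prob {\<omega> \<in> space M. inverse_mean (\<lambda>i. x i \<omega>) n \<le> trunc_mean s - \<epsilon>}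
    \<le> trunc_sq s / (n * \<epsilon>\<^sup>2)"
proof -
  note measurable_sample [measurable]
  have "prob {\<omega> \<in> space M. inverse_mean (\<lambda>i. x i \<omega>) n \<le> trunc_mean s - \<epsilon>}
    \<le> prob {\<omega> \<in> space M. \<epsilon> \<le> \<bar>(\<Sum>i=1..n. recip_above s (x i \<omega>)) / n - trunc_mean s\<bar>}"
  proof (rule finite_measure_mono_AE)
    show "AE \<omega> in M. \<omega> \<in> {\<omega> \<in> space M. inverse_mean (\<lambda>i. x i \<omega>) n \<le> trunc_mean s - \<epsilon>} \<longrightarrow>
      \<omega> \<in> {\<omega> \<in> space M. \<epsilon> \<le> \<bar>(\<Sum>i=1..n. recip_above s (x i \<omega>)) / n - trunc_mean s\<bar>}"
      using AE_all_sample_pos[of n]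
    proof eventually_elim
      case (elim \<omega>)
      then have "(\<Sum>i=1..n. recip_above s (x i \<omega>)) \<le> (\<Sum>i=1..n. 1 / x i \<omega>)"
        by (intro sum_mono recip_above_le_reciprocal) (auto simp: less_imp_le)
      then have "(\<Sum>i=1..n. recip_above s (x i \<omega>)) / n \<le> inverse_mean (\<lambda>i. x i \<omega>) n"
        by (simp add: inverse_mean_def divide_right_mono)
      then show ?case by auto
    qed
  qed measurable
  also note truncated_deviation[OF assms]
  finally show ?thesis .
qed

text \<open>If no sample lies below \<open>s\<close>, the truncated and full sums agree; the
  exceptional event costs the union bound over \<open>n\<close> samples.\<close>

lemma prob_inverse_mean_deviation:
  assumes "n > 0" "s > 0" "\<epsilon> > 0"
  shows "prob {\<omega> \<in> space M. \<epsilon> \<le> \<bar>inverse_mean (\<lambda>i. x i \<omega>) n - trunc_mean s\<bar>}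
    \<le> trunc_sq s / (n * \<epsilon>\<^sup>2) + n * prob {\<omega> \<in> space M. x 1 \<omega> < s}"
proof -
  note measurable_sample [measurable]
  let ?A = "{\<omega> \<in> space M. \<epsilon> \<le> \<bar>(\<Sum>i=1..n. recip_above s (x i \<omega>)) / n - trunc_mean s\<bar>}"
  let ?B = "\<lambda>i. {\<omega> \<in> space M. x i \<omega> < s}"
  have A[measurable]: "?A \<in> events" by measurable
  have B[measurable]: "?B i \<in> events" if "i \<in> {1..n}" for i
  proof -
    have [measurable]: "random_variable borel (x i)" using that measurable_sample by auto
    show ?thesis by measurable
  qed
  have "prob {\<omega> \<in> space M. \<epsilon> \<le> \<bar>inverse_mean (\<lambda>i. x i \<omega>) n - trunc_mean s\<bar>}
    \<le> prob (?A \<union> (\<Union>i\<in>{1..n}. ?B i))"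
  proof (rule finite_measure_mono)
    show "{\<omega> \<in> space M. \<epsilon> \<le> \<bar>inverse_mean (\<lambda>i. x i \<omega>) n - trunc_mean s\<bar>} \<subseteq> ?A \<union> (\<Union>i\<in>{1..n}. ?B i)"
    proof safe
      fix \<omega> assume \<omega>: "\<omega> \<in> space M" "\<epsilon> \<le> \<bar>inverse_mean (\<lambda>i. x i \<omega>) n - trunc_mean s\<bar>"
        "\<omega> \<notin> (\<Union>i\<in>{1..n}. ?B i)"
      then have "(\<Sum>i=1..n. recip_above s (x i \<omega>)) = (\<Sum>i=1..n. 1 / x i \<omega>)"
        by (intro sum.cong) (auto simp: recip_above_def not_less)
      then show "\<epsilon> \<le> \<bar>(\<Sum>i=1..n. recip_above s (x i \<omega>)) / n - trunc_mean s\<bar>"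
        using \<omega> by (simp add: inverse_mean_def)
    qed
  qed measurable
  also have "\<dots> \<le> prob ?A + prob (\<Union>i\<in>{1..n}. ?B i)"
    by (intro measure_Un_le) measurable
  also have "prob (\<Union>i\<in>{1..n}. ?B i) \<le> (\<Sum>i=1..n. prob (?B i))"
    using B by (intro finite_measure_subadditive_finite) auto
  also have "\<dots> = n * prob {\<omega> \<in> space M. x 1 \<omega> < s}"
    using prob_sample_less by simp
  finally show ?thesis using truncated_deviation[OF assms] by linarith
qed

section \<open>Weak law for integrable reciprocals\<close>

text \<open>With level \<open>1 / n\<close>, three limits are needed: of the truncated mean, of the
  truncated second moment over \<open>n\<close>, and of \<open>n\<close> times the probability of a
  sample below the level. Each follows by dominated convergence with dominating function
  \<open>1 / x 1 \<omega>\<close>.\<close>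

lemma inverse_mean_tendsto_expectation:
  assumes int: "integrable M (\<lambda>\<omega>. 1 / x 1 \<omega>)" and \<epsilon>: "\<epsilon> > 0"
  shows "(\<lambda>n. prob {\<omega> \<in> space M.
    \<epsilon> \<le> \<bar>inverse_mean (\<lambda>i. x i \<omega>) n - expectation (\<lambda>\<omega>. 1 / x 1 \<omega>)\<bar>}) \<longlonglongrightarrow> 0"
proof -
  let ?E = "expectation (\<lambda>\<omega>. 1 / x 1 \<omega>)"
  \<comment> \<open>\<open>Suc n\<close> keeps the level positive at every index; the shift is
    undone by \<open>LIMSEQ_imp_Suc\<close>.\<close>
  let ?s = "\<lambda>n. 1 / real (Suc n)"
  have ev: "\<forall>\<^sub>F n in sequentially. ?s n \<le> t" if "t > 0" for t :: real
    using order_tendstoD(2)[OF LIMSEQ_inverse_real_of_nat that]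
    by (auto simp: inverse_eq_divide elim: eventually_mono)
  have mean: "(\<lambda>n. trunc_mean (?s n)) \<longlonglongrightarrow> ?E"
    unfolding trunc_mean_def
  proof (rule integral_dominated_convergence[where w = "\<lambda>\<omega>. 1 / x 1 \<omega>"])
    show "AE \<omega> in M. (\<lambda>n. recip_above (?s n) (x 1 \<omega>)) \<longlonglongrightarrow> 1 / x 1 \<omega>"
      using AE_sample_pos[OF order_refl]
    proof eventually_elim
      case (elim \<omega>)
      then have "\<forall>\<^sub>F n in sequentially. recip_above (?s n) (x 1 \<omega>) = 1 / x 1 \<omega>"
        using ev[of "x 1 \<omega>"] by (auto simp: recip_above_def elim: eventually_mono)
      then show ?case by (rule tendsto_eventually)
    qed
    show "AE \<omega> in M. norm (recip_above (?s n) (x 1 \<omega>)) \<le> 1 / x 1 \<omega>" for n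
      using AE_sample_pos[OF order_refl]
      by eventually_elim (auto simp: recip_above_def)
  qed (use int in auto)
  have sq: "(\<lambda>n. trunc_sq (?s n) / Suc n) \<longlonglongrightarrow> 0"
  proof -
    have "(\<lambda>n. expectation (\<lambda>\<omega>. (recip_above (?s n) (x 1 \<omega>))\<^sup>2 / Suc n)) \<longlonglongrightarrow> expectation (\<lambda>_. 0)"
    proof (rule integral_dominated_convergence[where w = "\<lambda>\<omega>. 1 / x 1 \<omega>"])
      show "AE \<omega> in M. (\<lambda>n. (recip_above (?s n) (x 1 \<omega>))\<^sup>2 / Suc n) \<longlonglongrightarrow> 0"
        using AE_sample_pos[OF order_refl]
      proof eventually_elim
        case (elim \<omega>)
        show ?case
        proof (rule tendsto_sandwich[OF _ _ tendsto_const])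
          show "(\<lambda>n. (1 / x 1 \<omega>)\<^sup>2 / Suc n) \<longlonglongrightarrow> 0" by real_asymp
        qed (use elim in \<open>auto simp: recip_above_def\<close>)
      qed
      show "AE \<omega> in M. norm ((recip_above (?s n) (x 1 \<omega>))\<^sup>2 / Suc n) \<le> 1 / x 1 \<omega>" for n
        using AE_sample_pos[OF order_refl]
      proof eventually_elim
        case (elim \<omega>)
        \<comment> \<open>One factor of the square is bounded by \<open>1 / ?s n = Suc n\<close>,
          the other by the reciprocal itself.\<close>
        have "(recip_above (?s n) (x 1 \<omega>))\<^sup>2 \<le> Suc n * (1 / x 1 \<omega>)"
          unfolding power2_eq_square using elim recip_above_bounds[of "?s n" "x 1 \<omega>"]
          by (intro mult_mono recip_above_le_reciprocal) auto
        then show ?case by (simp add: field_simps)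
      qed
    qed (use int in auto)
    then show ?thesis by (simp add: trunc_sq_def)
  qed
  have tail: "(\<lambda>n. Suc n * prob {\<omega> \<in> space M. x 1 \<omega> < ?s n}) \<longlonglongrightarrow> 0"
  proof -
    have "(\<lambda>n. expectation (\<lambda>\<omega>. Suc n * indicat_real {..<?s n} (x 1 \<omega>))) \<longlonglongrightarrow> expectation (\<lambda>_. 0)"
    proof (rule integral_dominated_convergence[where w = "\<lambda>\<omega>. 1 / x 1 \<omega>"])
      show "AE \<omega> in M. (\<lambda>n. Suc n * indicat_real {..<?s n} (x 1 \<omega>)) \<longlonglongrightarrow> 0"
        using AE_sample_pos[OF order_refl]
      proof eventually_elim
        case (elim \<omega>)
        then have "\<forall>\<^sub>F n in sequentially. Suc n * indicat_real {..<?s n} (x 1 \<omega>) = 0"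
          using ev[of "x 1 \<omega>"] by (auto simp: indicator_def elim: eventually_mono)
        then show ?case by (rule tendsto_eventually)
      qed
      show "AE \<omega> in M. norm (Suc n * indicat_real {..<?s n} (x 1 \<omega>)) \<le> 1 / x 1 \<omega>" for n
        using AE_sample_pos[OF order_refl]
        by eventually_elim (auto simp: indicator_def field_simps)
    qed (use int in auto)
    then show ?thesis by (simp add: prob_sample_less del: of_nat_Suc)
  qed
  \<comment> \<open>The factor 4 arises since half of \<open>\<epsilon>\<close> is spent on the
    distance between the truncated and the full expectation.\<close>
  have "(\<lambda>n. 4 / \<epsilon>\<^sup>2 * (trunc_sq (?s n) / Suc n) + Suc n * prob {\<omega> \<in> space M. x 1 \<omega> < ?s n})
      \<longlonglongrightarrow> 4 / \<epsilon>\<^sup>2 * 0 + 0"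
    by (intro tendsto_intros sq tail)
  then have lim: "(\<lambda>n. 4 / \<epsilon>\<^sup>2 * (trunc_sq (?s n) / Suc n) + Suc n * prob {\<omega> \<in> space M. x 1 \<omega> < ?s n})
      \<longlonglongrightarrow> 0" by simp
  have "(\<lambda>n. prob {\<omega> \<in> space M. \<epsilon> \<le> \<bar>inverse_mean (\<lambda>i. x i \<omega>) (Suc n) - ?E\<bar>}) \<longlonglongrightarrow> 0"
  proof (rule tendsto_sandwich[OF _ _ tendsto_const lim])
    have "\<forall>\<^sub>F n in sequentially. dist (trunc_mean (?s n)) ?E < \<epsilon> / 2"
      using mean \<epsilon> by (intro tendstoD) auto
    then show "\<forall>\<^sub>F n in sequentially. prob {\<omega> \<in> space M. \<epsilon> \<le> \<bar>inverse_mean (\<lambda>i. x i \<omega>) (Suc n) - ?E\<bar>}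
      \<le> 4 / \<epsilon>\<^sup>2 * (trunc_sq (?s n) / Suc n) + Suc n * prob {\<omega> \<in> space M. x 1 \<omega> < ?s n}"
    proof eventually_elim
      case (elim n)
      have "prob {\<omega> \<in> space M. \<epsilon> \<le> \<bar>inverse_mean (\<lambda>i. x i \<omega>) (Suc n) - ?E\<bar>}
        \<le> prob {\<omega> \<in> space M. \<epsilon> / 2 \<le> \<bar>inverse_mean (\<lambda>i. x i \<omega>) (Suc n) - trunc_mean (?s n)\<bar>}"
      proof (intro finite_measure_mono Collect_mono impI conjI; (elim conjE)?)
        fix \<omega> assume "\<epsilon> \<le> \<bar>inverse_mean (\<lambda>i. x i \<omega>) (Suc n) - ?E\<bar>"
        then show "\<epsilon> / 2 \<le> \<bar>inverse_mean (\<lambda>i. x i \<omega>) (Suc n) - trunc_mean (?s n)\<bar>"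
          using elim unfolding dist_real_def by linarith
      qed auto
      also have "\<dots> \<le> trunc_sq (?s n) / (Suc n * (\<epsilon> / 2)\<^sup>2) + Suc n * prob {\<omega> \<in> space M. x 1 \<omega> < ?s n}"
        using \<epsilon> by (intro prob_inverse_mean_deviation) auto
      finally show ?case by (simp add: power_divide field_simps)
    qed
  qed auto
  then show ?thesis by (rule LIMSEQ_imp_Suc)
qed

section \<open>Truncated moments and the density near 0\<close>

text \<open>On the support of \<open>g\<close> the density lies between \<open>l\<close> and
  \<open>u\<close>, so the integral of \<open>f * g\<close> compares with that of \<open>g\<close>.
  The constant \<open>l\<close> may be negative, which occurs when it is the limit of the density
  minus an error.\<close>

lemma expectation_near_0:
  assumes [measurable]: "g \<in> borel_measurable borel"
    and int: "integrable lborel g" and nonneg: "\<And>t. 0 \<le> g t"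
    and supp: "\<And>t. t \<notin> {0<..\<delta>} \<Longrightarrow> g t = 0"
    and bd: "\<And>t. 0 < t \<Longrightarrow> t \<le> \<delta> \<Longrightarrow> l \<le> f t \<and> f t \<le> u"
  shows "integrable M (\<lambda>\<omega>. g (x 1 \<omega>))"
    and "l * (LINT t|lborel. g t) \<le> expectation (\<lambda>\<omega>. g (x 1 \<omega>))"
    and "expectation (\<lambda>\<omega>. g (x 1 \<omega>)) \<le> u * (LINT t|lborel. g t)"
proof -
  have bounds: "l * g t \<le> f t * g t" "f t * g t \<le> u * g t" for t
    using bd[of t] supp[of t] nonneg[of t]
    by (cases "t \<in> {0<..\<delta>}"; auto intro!: mult_right_mono)+
  have fint: "integrable lborel (\<lambda>t. f t * g t)"
    using int by (rule Bochner_Integration.integrable_bound[OF integrable_mult_right[of u]])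
      (auto intro!: AE_I2 order_trans[OF _ abs_ge_self] bounds simp: density_nonneg nonneg)
  then show "integrable M (\<lambda>\<omega>. g (x 1 \<omega>))"
    by (simp add: integrable_sample_iff)
  have "l * (LINT t|lborel. g t) = (LINT t|lborel. l * g t)" by simp
  also have "\<dots> \<le> (LINT t|lborel. f t * g t)"
    using fint int bounds by (intro integral_mono) auto
  finally show "l * (LINT t|lborel. g t) \<le> expectation (\<lambda>\<omega>. g (x 1 \<omega>))"
    by (simp add: expectation_sample)
  have "(LINT t|lborel. f t * g t) \<le> (LINT t|lborel. u * g t)"
    using fint int bounds by (intro integral_mono) auto
  then show "expectation (\<lambda>\<omega>. g (x 1 \<omega>)) \<le> u * (LINT t|lborel. g t)"
    by (simp add: expectation_sample)
qed

lemma prob_sample_less_le: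
  assumes bd: "\<And>t. 0 < t \<Longrightarrow> t \<le> \<delta> \<Longrightarrow> f t \<le> C" and s: "0 < s" "s \<le> \<delta>"
  shows "prob {\<omega> \<in> space M. x 1 \<omega> < s} \<le> C * s"
proof -
  have "prob {\<omega> \<in> space M. x 1 \<omega> < s} = expectation (\<lambda>\<omega>. indicator {..<s} (x 1 \<omega>))"
    by (simp add: prob_sample_less)
  \<comment> \<open>Discarding the null event of nonpositive samples brings the indicator into the
    region where \<open>f\<close> is controlled.\<close>
  also have "\<dots> = expectation (\<lambda>\<omega>. indicator {0<..<s} (x 1 \<omega>))"
    using AE_sample_pos[OF order_refl]
    by (intro integral_cong_AE) (auto simp: indicator_def)
  also have "\<dots> \<le> C * (LINT t|lborel. indicator {0<..<s} t)"
    using s bd density_nonneg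
    by (intro expectation_near_0(3)[where l = 0 and \<delta> = \<delta>]) (auto split: split_indicator)
  also have "\<dots> = C * s" using s by simp
  finally show ?thesis .
qed

text \<open>Up to \<open>\<delta>\<close> the integral of \<open>1 / t\<^sup>2\<close> from
  \<open>s\<close> is \<open>1 / s - 1 / \<delta>\<close>. Beyond \<open>\<delta>\<close> the
  squared reciprocal is at most \<open>1 / \<delta>\<^sup>2\<close>, whatever \<open>f\<close> does
  there.\<close>

lemma trunc_sq_le:
  assumes bd: "\<And>t. 0 < t \<Longrightarrow> t \<le> \<delta> \<Longrightarrow> f t \<le> C" and C: "C \<ge> 0" and s: "0 < s" "s \<le> \<delta>"
  shows "trunc_sq s \<le> C / s + 1 / \<delta>\<^sup>2"
proof -
  let ?g = "\<lambda>t::real. (1 / t\<^sup>2) * indicator {s..\<delta>} t"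
  have g: "has_bochner_integral lborel ?g (- 1 / \<delta> - (- 1 / s))"
    using s by (intro has_bochner_integral_FTC_Icc_real)
      (auto intro!: derivative_eq_intros continuous_intros simp: power2_eq_square field_simps)
  have intg: "integrable M (\<lambda>\<omega>. ?g (x 1 \<omega>))"
    and le: "expectation (\<lambda>\<omega>. ?g (x 1 \<omega>)) \<le> C * (LINT t|lborel. ?g t)"
    using expectation_near_0[of ?g \<delta> 0 C] g s bd density_nonneg
    by (auto simp: has_bochner_integral_iff indicator_def)
  have "trunc_sq s \<le> expectation (\<lambda>\<omega>. ?g (x 1 \<omega>) + 1 / \<delta>\<^sup>2)"
    unfolding trunc_sq_def
  proof (rule integral_mono)
    show "(recip_above s (x 1 \<omega>))\<^sup>2 \<le> ?g (x 1 \<omega>) + 1 / \<delta>\<^sup>2" for \<omega>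
      using s by (auto simp: recip_above_def indicator_def power_one_over
          intro!: divide_left_mono power_mono)
  qed (use s intg integrable_recip_above_sq in auto)
  also have "\<dots> = expectation (\<lambda>\<omega>. ?g (x 1 \<omega>)) + 1 / \<delta>\<^sup>2"
    using intg by (subst Bochner_Integration.integral_add) (auto simp: prob_space)
  also have "\<dots> \<le> C * (1 / s - 1 / \<delta>) + 1 / \<delta>\<^sup>2"
    using le g by (simp add: has_bochner_integral_iff)
  also have "\<dots> \<le> C * (1 / s) + 1 / \<delta>\<^sup>2"
    using C s by (intro add_right_mono mult_left_mono) auto
  finally show ?thesis by simp
qed

text \<open>The logarithms come from integrating \<open>1 / t\<close> over
  \<open>{s..\<delta>}\<close>. Samples above \<open>\<delta>\<close> contribute between 0 and
  \<open>1 / \<delta>\<close>.\<close>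

lemma trunc_mean_bounds:
  assumes bd: "\<And>t. 0 < t \<Longrightarrow> t \<le> \<delta> \<Longrightarrow> l \<le> f t \<and> f t \<le> u" and s: "0 < s" "s \<le> \<delta>"
  shows "l * (ln \<delta> - ln s) \<le> trunc_mean s" "trunc_mean s \<le> u * (ln \<delta> - ln s) + 1 / \<delta>"
proof -
  let ?g = "\<lambda>t::real. (1 / t) * indicator {s..\<delta>} t"
  have g: "has_bochner_integral lborel ?g (ln \<delta> - ln s)"
    using s by (intro has_bochner_integral_FTC_Icc_real)
      (auto intro!: derivative_eq_intros continuous_intros simp: field_simps)
  have intg: "integrable M (\<lambda>\<omega>. ?g (x 1 \<omega>))"
    and ge: "l * (LINT t|lborel. ?g t) \<le> expectation (\<lambda>\<omega>. ?g (x 1 \<omega>))"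
    and le: "expectation (\<lambda>\<omega>. ?g (x 1 \<omega>)) \<le> u * (LINT t|lborel. ?g t)"
    using expectation_near_0[of ?g \<delta> l u] g s bd
    by (auto simp: has_bochner_integral_iff indicator_def)
  have "expectation (\<lambda>\<omega>. ?g (x 1 \<omega>)) \<le> trunc_mean s"
    unfolding trunc_mean_def
    using s intg integrable_recip_above by (intro integral_mono) (auto simp: recip_above_def indicator_def)
  then show "l * (ln \<delta> - ln s) \<le> trunc_mean s"
    using ge g by (simp add: has_bochner_integral_iff)
  have "trunc_mean s \<le> expectation (\<lambda>\<omega>. ?g (x 1 \<omega>) + 1 / \<delta>)"
    unfolding trunc_mean_def
  proof (rule integral_mono)
    show "recip_above s (x 1 \<omega>) \<le> ?g (x 1 \<omega>) + 1 / \<delta>" for \<omega>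
      using s by (auto simp: recip_above_def indicator_def intro!: divide_left_mono)
  qed (use s intg integrable_recip_above in auto)
  also have "\<dots> = expectation (\<lambda>\<omega>. ?g (x 1 \<omega>)) + 1 / \<delta>"
    using intg by (subst Bochner_Integration.integral_add) (auto simp: prob_space)
  finally show "trunc_mean s \<le> u * (ln \<delta> - ln s) + 1 / \<delta>"
    using le g by (simp add: has_bochner_integral_iff)
qed

text \<open>Near 0 the density is within \<open>e / 2\<close> of \<open>c\<close> up to a fixed
  \<open>\<delta>\<close>, and \<open>ln \<delta>\<close> and \<open>1 / \<delta>\<close> are
  negligible against \<open>ln (1 / s)\<close>. The other \<open>e / 2\<close> absorbs these
  errors.\<close>

lemma trunc_mean_asymptotics:
  assumes lim: "(f \<longlongrightarrow> c) (at_right 0)"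
  shows "((\<lambda>s. trunc_mean s / ln (1 / s)) \<longlongrightarrow> c) (at_right 0)"
proof (rule tendstoI)
  fix e :: real assume e: "e > 0"
  then have "\<forall>\<^sub>F t in at_right 0. dist (f t) c < e / 2"
    using lim by (intro tendstoD) auto
  then obtain b where b: "b > 0" "\<And>t. 0 < t \<Longrightarrow> t < b \<Longrightarrow> dist (f t) c < e / 2"
    unfolding eventually_at_right_field by auto
  \<comment> \<open>Halving \<open>b\<close> places the closed endpoint inside the open interval
    where the estimate holds.\<close>
  define \<delta> where "\<delta> = b / 2"
  have \<delta>: "\<delta> > 0" and bd: "\<And>t. 0 < t \<Longrightarrow> t \<le> \<delta> \<Longrightarrow> c - e / 2 \<le> f t \<and> f t \<le> c + e / 2"
  proof -
    show "\<delta> > 0" using b by (simp add: \<delta>_def)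
    show "c - e / 2 \<le> f t \<and> f t \<le> c + e / 2" if "0 < t" "t \<le> \<delta>" for t
      using b(1) b(2)[of t] that unfolding \<delta>_def dist_real_def by linarith
  qed
  have ratio: "((\<lambda>s. (ln \<delta> - ln s) / ln (1 / s)) \<longlongrightarrow> 1) (at_right 0)"
    using \<delta> by real_asymp
  have rest: "((\<lambda>s. 1 / \<delta> / ln (1 / s)) \<longlongrightarrow> 0) (at_right 0)"
    using \<delta> by real_asymp
  have "((\<lambda>s. (c - e / 2) * ((ln \<delta> - ln s) / ln (1 / s))) \<longlongrightarrow> (c - e / 2) * 1) (at_right 0)"
    by (intro tendsto_intros ratio)
  from order_tendstoD(1)[OF this, of "c - e"]
  have low: "\<forall>\<^sub>F s in at_right 0. c - e < (c - e / 2) * ((ln \<delta> - ln s) / ln (1 / s))"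
    using e by simp
  have "((\<lambda>s. (c + e / 2) * ((ln \<delta> - ln s) / ln (1 / s)) + 1 / \<delta> / ln (1 / s))
      \<longlongrightarrow> (c + e / 2) * 1 + 0) (at_right 0)"
    by (intro tendsto_intros ratio rest)
  from order_tendstoD(2)[OF this, of "c + e"]
  have up: "\<forall>\<^sub>F s in at_right 0. (c + e / 2) * ((ln \<delta> - ln s) / ln (1 / s)) + 1 / \<delta> / ln (1 / s) < c + e"
    using e by simp
  have small: "\<forall>\<^sub>F s in at_right 0. 0 < s \<and> s < min \<delta> 1"
    unfolding eventually_at_right_field using \<delta> by (intro exI[of _ "min \<delta> 1"]) auto
  show "\<forall>\<^sub>F s in at_right 0. dist (trunc_mean s / ln (1 / s)) c < e"
    using low up small
  proof eventually_elim
    case (elim s)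
    then have L: "ln (1 / s) > 0" by simp
    have s: "0 < s" "s \<le> \<delta>" using elim by auto
    note b = trunc_mean_bounds[of \<delta> "c - e / 2" "c + e / 2" s, OF bd s]
    have "(c - e / 2) * ((ln \<delta> - ln s) / ln (1 / s)) \<le> trunc_mean s / ln (1 / s)"
      using divide_right_mono[OF b(1), of "ln (1 / s)"] L by simp
    moreover have "trunc_mean s / ln (1 / s)
        \<le> (c + e / 2) * ((ln \<delta> - ln s) / ln (1 / s)) + 1 / \<delta> / ln (1 / s)"
      using divide_right_mono[OF b(2), of "ln (1 / s)"] L by (simp add: add_divide_distrib)
    ultimately show ?case using elim unfolding dist_real_def by linarith
  qed
qed

section \<open>Logarithmic scaling when the density has a positive limit at 0\<close>

lemma scaled_inverse_mean_limits:
  assumes lim: "(f \<longlongrightarrow> c) (at_right 0)" and c: "c > 0"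
  defines "A \<equiv> \<lambda>n \<omega>. inverse_mean (\<lambda>i. x i \<omega>) n / ln (real n)"
  shows "\<epsilon> > 0 \<Longrightarrow> (\<lambda>n. prob {\<omega> \<in> space M. \<epsilon> \<le> \<bar>A n \<omega> - c\<bar>}) \<longlonglongrightarrow> 0"
    and "(\<lambda>n. ln (real n) * prob {\<omega> \<in> space M. A n \<omega> \<le> c / 2}) \<longlonglongrightarrow> 0"
proof -
  \<comment> \<open>The level \<open>1 / s n = n * sqrt (ln n)\<close> must exceed \<open>n\<close> in order, so that with high
    probability no term is truncated, and be \<open>o(n * ln n)\<close>, so that the lower deviation
    stays \<open>o(1 / ln n)\<close>.\<close>
  define s where "s = (\<lambda>n. 1 / (real n * sqrt (ln (real n))))"
  have "\<forall>\<^sub>F t in at_right 0. f t < c + 1"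
    using lim by (rule order_tendstoD) simp
  then obtain b where b: "b > 0" "\<And>t. 0 < t \<Longrightarrow> t < b \<Longrightarrow> f t < c + 1"
    unfolding eventually_at_right_field by auto
  define \<delta> where "\<delta> = b / 2"
  have \<delta>: "\<delta> > 0" and bd: "\<And>t. 0 < t \<Longrightarrow> t \<le> \<delta> \<Longrightarrow> f t \<le> c + 1"
    using b by (force simp: \<delta>_def)+
  have C: "c + 1 \<ge> 0" using c by simp
  have s0: "filterlim s (at_right 0) sequentially"
    unfolding s_def by real_asymp
  have s_small: "\<forall>\<^sub>F n in sequentially. 0 < s n \<and> s n \<le> \<delta>"
  proof -
    have "\<forall>\<^sub>F t in at_right 0. 0 < t \<and> t \<le> \<delta>"
      unfolding eventually_at_right_field using \<delta> by (intro exI[of _ \<delta>]) auto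
    then show ?thesis using s0 by (rule eventually_compose_filterlim)
  qed
  have mean: "(\<lambda>n. trunc_mean (s n) / ln (real n)) \<longlonglongrightarrow> c"
  proof -
    have "(\<lambda>n. trunc_mean (s n) / ln (1 / s n)) \<longlonglongrightarrow> c"
      using filterlim_compose[OF trunc_mean_asymptotics[OF lim] s0] .
    \<comment> \<open>Here \<open>ln (1 / s n)\<close> is \<open>ln n + ln (ln n) / 2\<close>, so
      either logarithm may serve as the scale.\<close>
    moreover have "(\<lambda>n. ln (1 / s n) / ln (real n)) \<longlonglongrightarrow> 1"
      unfolding s_def by real_asymp
    ultimately have "(\<lambda>n. trunc_mean (s n) / ln (1 / s n) * (ln (1 / s n) / ln (real n))) \<longlonglongrightarrow> c * 1"
      by (rule tendsto_mult)
    moreover have "\<forall>\<^sub>F n in sequentially. ln (1 / s n) > 0"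
      unfolding s_def by real_asymp
    then have "\<forall>\<^sub>F n in sequentially. trunc_mean (s n) / ln (1 / s n) * (ln (1 / s n) / ln (real n))
        = trunc_mean (s n) / ln (real n)"
      by eventually_elim simp
    ultimately show ?thesis by (auto intro: Lim_transform_eventually)
  qed
  have large: "\<forall>\<^sub>F n::nat in sequentially. n > 1"
    by (rule eventually_gt_at_top)
  {
    fix \<epsilon> :: real assume \<epsilon>: "\<epsilon> > 0"
    have C1: "c + 1 > 0" using c by simp
    \<comment> \<open>The second-moment term is of order \<open>(ln n) powr (- 3 / 2)\<close> and
      the union-bound term equals \<open>(c + 1) / sqrt (ln n)\<close> for large
      \<open>n\<close>.\<close>
    have lim0: "(\<lambda>n. ((c + 1) / s n + 1 / \<delta>\<^sup>2) / (n * (\<epsilon> / 2 * ln (real n))\<^sup>2) + n * ((c + 1) * s n)) \<longlonglongrightarrow> 0"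
      unfolding s_def using C1 \<delta> \<epsilon> by real_asymp
    show "(\<lambda>n. prob {\<omega> \<in> space M. \<epsilon> \<le> \<bar>A n \<omega> - c\<bar>}) \<longlonglongrightarrow> 0"
    proof (rule tendsto_sandwich[OF _ _ tendsto_const lim0])
      have "\<forall>\<^sub>F n in sequentially. dist (trunc_mean (s n) / ln (real n)) c < \<epsilon> / 2"
        using mean \<epsilon> by (intro tendstoD) auto
      then show "\<forall>\<^sub>F n in sequentially. prob {\<omega> \<in> space M. \<epsilon> \<le> \<bar>A n \<omega> - c\<bar>}
          \<le> ((c + 1) / s n + 1 / \<delta>\<^sup>2) / (n * (\<epsilon> / 2 * ln (real n))\<^sup>2) + n * ((c + 1) * s n)"
        using large s_small
      proof eventually_elim
        case (elim n)
        then have L: "ln (real n) > 0" by simp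
        have "prob {\<omega> \<in> space M. \<epsilon> \<le> \<bar>A n \<omega> - c\<bar>}
          \<le> prob {\<omega> \<in> space M. \<epsilon> / 2 * ln (real n) \<le> \<bar>inverse_mean (\<lambda>i. x i \<omega>) n - trunc_mean (s n)\<bar>}"
        proof (intro finite_measure_mono Collect_mono impI conjI; (elim conjE)?)
          fix \<omega> assume "\<epsilon> \<le> \<bar>A n \<omega> - c\<bar>"
          then have "\<epsilon> / 2 \<le> \<bar>A n \<omega> - trunc_mean (s n) / ln (real n)\<bar>"
            using elim unfolding dist_real_def by linarith
          also have "\<dots> = \<bar>inverse_mean (\<lambda>i. x i \<omega>) n - trunc_mean (s n)\<bar> / ln (real n)"
            using L by (simp add: A_def diff_divide_distrib[symmetric])
          finally show "\<epsilon> / 2 * ln (real n) \<le> \<bar>inverse_mean (\<lambda>i. x i \<omega>) n - trunc_mean (s n)\<bar>"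
            using L by (simp add: field_simps)
        qed auto
        also have "\<dots> \<le> trunc_sq (s n) / (n * (\<epsilon> / 2 * ln (real n))\<^sup>2) + n * prob {\<omega> \<in> space M. x 1 \<omega> < s n}"
          using \<epsilon> L elim by (intro prob_inverse_mean_deviation) auto
        also have "\<dots> \<le> ((c + 1) / s n + 1 / \<delta>\<^sup>2) / (n * (\<epsilon> / 2 * ln (real n))\<^sup>2) + n * ((c + 1) * s n)"
          using elim bd C by (intro add_mono divide_right_mono mult_left_mono trunc_sq_le prob_sample_less_le) auto
        finally show ?case .
      qed
    qed auto
  }
  have C1: "c + 1 > 0" using c by simp
  \<comment> \<open>After multiplication by \<open>ln n\<close> the second-moment term is still of
    order \<open>1 / sqrt (ln n)\<close>.\<close>
  have lim0: "(\<lambda>n. ln (real n) * (((c + 1) / s n + 1 / \<delta>\<^sup>2) / (n * (c / 4 * ln (real n))\<^sup>2))) \<longlonglongrightarrow> 0"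
    unfolding s_def using C1 c \<delta> by real_asymp
  show "(\<lambda>n. ln (real n) * prob {\<omega> \<in> space M. A n \<omega> \<le> c / 2}) \<longlonglongrightarrow> 0"
  proof (rule tendsto_sandwich[OF _ _ tendsto_const lim0])
    have "\<forall>\<^sub>F n in sequentially. 3 * c / 4 < trunc_mean (s n) / ln (real n)"
      using mean c by (intro order_tendstoD(1)) auto
    then show "\<forall>\<^sub>F n in sequentially. ln (real n) * prob {\<omega> \<in> space M. A n \<omega> \<le> c / 2}
        \<le> ln (real n) * (((c + 1) / s n + 1 / \<delta>\<^sup>2) / (n * (c / 4 * ln (real n))\<^sup>2))"
      using large s_small
    proof eventually_elim
      case (elim n)
      then have L: "ln (real n) > 0" by simp
      \<comment> \<open>The truncated mean exceeds \<open>3 * c / 4 * ln n\<close>, so falling to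
        \<open>c / 2 * ln n\<close> is a deviation of at least \<open>c / 4 * ln n\<close>.\<close>
      have "prob {\<omega> \<in> space M. A n \<omega> \<le> c / 2}
        \<le> prob {\<omega> \<in> space M. inverse_mean (\<lambda>i. x i \<omega>) n \<le> trunc_mean (s n) - c / 4 * ln (real n)}"
      proof (intro finite_measure_mono Collect_mono impI conjI; (elim conjE)?)
        fix \<omega> assume "A n \<omega> \<le> c / 2"
        then have "inverse_mean (\<lambda>i. x i \<omega>) n \<le> c / 2 * ln (real n)"
          using L by (simp add: A_def field_simps)
        moreover have "3 * c / 4 * ln (real n) < trunc_mean (s n)"
          using elim L by (simp add: field_simps)
        ultimately show "inverse_mean (\<lambda>i. x i \<omega>) n \<le> trunc_mean (s n) - c / 4 * ln (real n)"
          by (simp add: field_simps)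
      qed auto
      also have "\<dots> \<le> trunc_sq (s n) / (n * (c / 4 * ln (real n))\<^sup>2)"
        using c L elim by (intro prob_inverse_mean_lower) auto
      also have "\<dots> \<le> ((c + 1) / s n + 1 / \<delta>\<^sup>2) / (n * (c / 4 * ln (real n))\<^sup>2)"
        using elim bd C by (intro divide_right_mono trunc_sq_le) auto
      finally show ?case using L by (intro mult_left_mono) auto
    qed
    show "\<forall>\<^sub>F n in sequentially. 0 \<le> ln (real n) * prob {\<omega> \<in> space M. A n \<omega> \<le> c / 2}"
      using large by eventually_elim auto
  qed
qed

section \<open>Integrability of the reciprocal for a density vanishing like a power\<close>

text \<open>Near 0, \<open>f t / t\<close> is at most \<open>2 * c * t powr (\<beta> - 1)\<close>,
  which is integrable at 0 because \<open>\<beta> > 0\<close>; above \<open>\<delta>\<close> the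
  reciprocal is at most \<open>1 / \<delta>\<close>.\<close>

lemma integrable_reciprocal:
  assumes lim: "((\<lambda>t. f t / (c * t powr \<beta>)) \<longlongrightarrow> 1) (at_right 0)"
    and c: "c > 0" and \<beta>: "\<beta> > 0"
  shows "integrable M (\<lambda>\<omega>. 1 / x 1 \<omega>)"
proof -
  have "\<forall>\<^sub>F t in at_right 0. f t / (c * t powr \<beta>) < 2"
    using lim by (rule order_tendstoD) simp
  then obtain b where b: "b > 0" "\<And>t. 0 < t \<Longrightarrow> t < b \<Longrightarrow> f t / (c * t powr \<beta>) < 2"
    unfolding eventually_at_right_field by auto
  define \<delta> where "\<delta> = b / 2"
  have \<delta>: "\<delta> > 0" using b by (simp add: \<delta>_def)
  have bd: "f t \<le> 2 * c * t powr \<beta>" if "0 < t" "t \<le> \<delta>" for t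
  proof -
    have "c * t powr \<beta> > 0" using that c by simp
    moreover have "f t / (c * t powr \<beta>) < 2" using b that by (auto simp: \<delta>_def)
    ultimately show ?thesis by (simp add: field_simps)
  qed
  let ?g = "\<lambda>t::real. (1 / t) * indicator {0<..\<delta>} t"
  let ?p = "\<lambda>t::real. indicator {0..\<delta>} t *\<^sub>R t powr (\<beta> - 1)"
  \<comment> \<open>The gauge integral of the power is absolute by nonnegativity; it then passes
    from the completed measure to \<open>lborel\<close>.\<close>
  have "(\<lambda>t. t powr (\<beta> - 1)) absolutely_integrable_on {0..\<delta>}"
    using \<beta> \<delta> by (intro nonnegative_absolutely_integrable_1 integrable_on_powr_from_0) auto
  then have p: "integrable lborel ?p"
    unfolding set_integrable_def by (subst (asm) integrable_completion) auto
  have "integrable lborel (\<lambda>t. f t * ?g t)"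
  proof (rule Bochner_Integration.integrable_bound[OF integrable_mult_right[OF p, of "2 * c"]])
    have "f t * ?g t \<le> 2 * c * ?p t" for t
    proof (cases "t \<in> {0<..\<delta>}")
      case True
      then have "f t / t \<le> 2 * c * t powr \<beta> / t" using bd by (intro divide_right_mono) auto
      also have "\<dots> = 2 * c * t powr (\<beta> - 1)" using True by (simp add: powr_diff)
      finally show ?thesis using True by simp
    next
      case False
      then show ?thesis using c by simp
    qed
    moreover have "0 \<le> f t * ?g t" for t using density_nonneg by (simp add: indicator_def)
    ultimately show "AE t in lborel. norm (f t * ?g t) \<le> norm (2 * c * ?p t)"
      by (intro AE_I2) (metis abs_ge_self abs_of_nonneg order_trans real_norm_def)
  qed measurable
  then have g: "integrable M (\<lambda>\<omega>. ?g (x 1 \<omega>))"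
    by (subst integrable_sample_iff) auto
  have "integrable M (\<lambda>\<omega>. ?g (x 1 \<omega>) + 1 / \<delta>)"
    using g by simp
  then show ?thesis
  proof (rule Bochner_Integration.integrable_bound)
    show "AE \<omega> in M. norm (1 / x 1 \<omega>) \<le> norm (?g (x 1 \<omega>) + 1 / \<delta>)"
      using AE_sample_pos[OF order_refl]
      by eventually_elim (use \<delta> in \<open>auto simp: indicator_def intro!: divide_left_mono order_trans[OF _ abs_ge_self]\<close>)
  qed measurable
qed

end

section \<open>The limit laws for the harmonic mean\<close>

text \<open>Convergence and integrability are asserted as well, since \<open>lim\<close> and the
  expectation carry the intended meaning only under them.\<close>

theorem theoremH:
  fixes M :: "'a measure" and x :: "nat \<Rightarrow> 'a \<Rightarrow> real"
    and f :: "real \<Rightarrow> real" and c \<beta> a :: real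
    and H :: "nat \<Rightarrow> 'a \<Rightarrow> real"
  defines "H \<equiv> (\<lambda>n \<omega>. harmonic_mean (\<lambda>i. x i \<omega>) n)"
  assumes "prob_space M"
    and "prob_space.indep_vars M (\<lambda>_. borel) x {1..}"
    and "\<And>i. i \<ge> 1 \<Longrightarrow> AE \<omega> in M. x i \<omega> \<in> {0..1}"
    and "\<And>t. f t \<ge> 0"
    and "\<And>i. i \<ge> 1 \<Longrightarrow> distributed M lborel (x i) (\<lambda>t. ennreal (f t))"
    and "c > 0" and "\<beta> \<ge> 0"
    and "((\<lambda>t. f t / (c * t powr \<beta>)) \<longlongrightarrow> 1) (at_right 0)"
    and "a > 0"
  shows "(\<beta> = 0 \<longrightarrow>
           convergent (\<lambda>n. prob_space.expectation M (\<lambda>\<omega>. H n \<omega> * ln (real n))) \<and>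
           (let C1 = lim (\<lambda>n. prob_space.expectation M (\<lambda>\<omega>. H n \<omega> * ln (real n)))
            in (\<lambda>n. prob_space.prob M {\<omega> \<in> space M. \<bar>H n \<omega> * ln (real n) - C1\<bar> > a})
                 \<longlonglongrightarrow> 0)) \<and>
         (\<beta> > 0 \<longrightarrow>
           integrable M (\<lambda>\<omega>. 1 / x 1 \<omega>) \<and>
           (let E = prob_space.expectation M (\<lambda>\<omega>. 1 / x 1 \<omega>)
            in (\<lambda>n. prob_space.prob M {\<omega> \<in> space M. \<bar>H n \<omega> - 1 / E\<bar> > a})
                 \<longlonglongrightarrow> 0))"
proof -
  interpret prob_space M by fact
  interpret unit_sample M x f
    using assms by unfold_locales auto
  show ?thesis
  proof (intro conjI impI)
    assume \<beta>: "\<beta> = 0"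
    let ?A = "\<lambda>n \<omega>. inverse_mean (\<lambda>i. x i \<omega>) n / ln (real n)"
    have H: "(\<lambda>\<omega>. H n \<omega> * ln (real n)) = (\<lambda>\<omega>. 1 / ?A n \<omega>)" for n
      by (simp add: H_def harmonic_mean_def)
    \<comment> \<open>For \<open>\<beta> = 0\<close> the power is 1 at every positive
      \<open>t\<close>, so the hypothesis on the quotient says that \<open>f\<close> tends to
      \<open>c\<close>.\<close>
    have f: "(f \<longlongrightarrow> c) (at_right 0)"
    proof -
      have "((\<lambda>t. c * (f t / (c * t powr \<beta>))) \<longlongrightarrow> c * 1) (at_right 0)"
        by (intro tendsto_intros assms)
      moreover have "\<forall>\<^sub>F t in at_right 0. c * (f t / (c * t powr \<beta>)) = f t"
        by (rule eventually_mono[OF eventually_at_right_less]) (use \<open>c > 0\<close> \<beta> in auto)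
      ultimately show ?thesis by (auto intro: Lim_transform_eventually)
    qed
    note conv = scaled_inverse_mean_limits[OF f \<open>c > 0\<close>]
    have E: "(\<lambda>n. expectation (\<lambda>\<omega>. H n \<omega> * ln (real n))) \<longlonglongrightarrow> 1 / c"
      unfolding H
    proof (rule expectation_reciprocal_tendsto[OF _ \<open>c > 0\<close> conv(1), where L = "\<lambda>n. ln (real n)"])
      show "\<forall>\<^sub>F n in sequentially. ln (real n) > 0 \<and> (AE \<omega> in M. 1 / ln (real n) \<le> ?A n \<omega>)"
        using eventually_gt_at_top[of 1]
      proof eventually_elim
        case (elim n)
        then have "ln (real n) > 0" by simp
        moreover have "AE \<omega> in M. 1 / ln (real n) \<le> ?A n \<omega>"
          using AE_inverse_mean_ge_1[of n] elim
          by (auto elim!: eventually_mono intro: divide_right_mono)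
        ultimately show ?case by simp
      qed
    qed (use conv(2) in auto)
    then show "convergent (\<lambda>n. expectation (\<lambda>\<omega>. H n \<omega> * ln (real n)))"
      by (rule convergentI)
    have "(\<lambda>n. prob {\<omega> \<in> space M. \<bar>1 / ?A n \<omega> - 1 / c\<bar> > a}) \<longlonglongrightarrow> 0"
      using \<open>c > 0\<close> \<open>a > 0\<close> conv(1) by (intro reciprocal_tendsto_in_prob) auto
    then show "let C1 = lim (\<lambda>n. expectation (\<lambda>\<omega>. H n \<omega> * ln (real n)))
        in (\<lambda>n. prob {\<omega> \<in> space M. \<bar>H n \<omega> * ln (real n) - C1\<bar> > a}) \<longlonglongrightarrow> 0"
      unfolding limI[OF E] Let_def by (simp add: H_def harmonic_mean_def)
  next
    assume "\<beta> > 0"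
    show int: "integrable M (\<lambda>\<omega>. 1 / x 1 \<omega>)"
      using assms \<open>\<beta> > 0\<close> by (intro integrable_reciprocal)
    \<comment> \<open>The expectation must be positive for the reciprocal to be continuous there;
      samples in \<open>{0<..1}\<close> make it at least 1.\<close>
    have "AE \<omega> in M. 1 \<le> 1 / x 1 \<omega>"
      using AE_sample_pos[OF order_refl] by eventually_elim simp
    then have "1 \<le> expectation (\<lambda>\<omega>. 1 / x 1 \<omega>)"
      using int by (intro integral_ge_const)
    then have "(\<lambda>n. prob {\<omega> \<in> space M. \<bar>1 / inverse_mean (\<lambda>i. x i \<omega>) n - 1 / expectation (\<lambda>\<omega>. 1 / x 1 \<omega>)\<bar> > a}) \<longlonglongrightarrow> 0"
      using \<open>a > 0\<close> int by (intro reciprocal_tendsto_in_prob inverse_mean_tendsto_expectation) auto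
    then show "let E = expectation (\<lambda>\<omega>. 1 / x 1 \<omega>)
        in (\<lambda>n. prob {\<omega> \<in> space M. \<bar>H n \<omega> - 1 / E\<bar> > a}) \<longlonglongrightarrow> 0"
      by (simp add: H_def harmonic_mean_def)
  qed
qed

end
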